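(* Let $\circ$ be an admissible fusion map, $n\ge 1$, let $f,g\colon X\to Y$ be measurable and let $\mu,\nu$ be monotone measures on $(X,\mathcal{A})$. Then: (a) $\mathrm{Su}^{\circ}_{n}(\mu,f)\le \mathrm{Su}^{\circ}_{n}(\mu,g)$ whenever $\mu(\{f\ge t\})\le\mu(\{g\ge t\})$ for all $t$. (b) $\mathrm{Su}^{\circ}_{n}(\mu,f)\le \mathrm{Su}^{\circ}_{n}(\nu,f)$ whenever $\mu(A)\le\nu(A)$ for all $A\in\mathcal{A}$. (c) $\mathrm{Su}^{\circ}_{n}(\mu,a\mathbb{1}_A)=s_n(a,\mu(A))$ for all $a\in Y$ and $A\in\mathcal{A}$, where $s_n\colon Y\times[0,\infty]\to Y$ ($n\ge1$) are nondecreasing functions such that $s_n(a,0)=s_n(0,b)=0$ and $s_{n+1}(a,b)=(a\circ s_n(a,b))\wedge b$ for all $a\in Y$, $b\in[0,\infty]$.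
   Context: $(X,\mathcal{A})$ is a measurable space with $X\neq\emptyset$ ($\mathcal{A}$ a $\sigma$-algebra), and $Y=[0,\bar y]$ with $0<\bar y\le\infty$. Notation: $a\wedge b=\min(a,b)$, $\{f\ge t\}=\{x\in X: f(x)\ge t\}$, $\mathbb{1}_A$ is the indicator function of $A$. A function of two variables is nondecreasing if it is nondecreasing in the componentwise order. A monotone measure on $(X,\mathcal{A})$ is a set function $\mu\colon\mathcal{A}\to[0,\infty]$ with $\mu(A)\le\mu(B)$ whenever $A\subset B$, $\mu(\emptyset)=0$ and $\mu(X)>0$. An admissible fusion map is a nondecreasing map $\circ\colon Y\times Y\to Y$ (i.e. $a_1\circ a_2\le b_1\circ b_2$ whenever $a_i\le b_i$) such that $0\circ a\le a$ for all $a\in Y$. The upper $n$-Sugeno integral of a measurable $f\colon X\to Y$ is defined recursively by $$\mathrm{Su}^{\circ}_{1}(\mu,f)=\sup_{t\in Y}\{t\wedge\mu(\{f\ge t\})\},\qquad \mathrm{Su}^{\circ}_{n+1}(\mu,f)=\sup_{t\in Y}\big\{(t\circ\mathrm{Su}^{\circ}_{n}(\mu,f))\wedge\mu(\{f\ge t\})\big\}.$$ *)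

theory Defs
  imports "HOL-Analysis.Analysis"
begin

text \<open>
  The scale \<open>Y = [0, ybar]\<close> is the set \<open>{0..ybar}\<close> of extended nonnegative reals;
  \<open>ybar = \<infinity>\<close> is allowed. A \<^typ>\<open>'a measure\<close> \<open>M\<close> serves only as a measurable space
  \<open>(space M, sets M)\<close>; its own measure is never used, and monotone measures are separate
  set functions, whose values outside \<^term>\<open>sets M\<close> are irrelevant.
\<close>

definition monotone_measure :: "'a measure \<Rightarrow> ('a set \<Rightarrow> ennreal) \<Rightarrow> bool" where
  "monotone_measure M \<mu> \<longleftrightarrow>
     (\<forall>A\<in>sets M. \<forall>B\<in>sets M. A \<subseteq> B \<longrightarrow> \<mu> A \<le> \<mu> B) \<and> \<mu> {} = 0 \<and> \<mu> (space M) > 0"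

definition admissible_fusion :: "ennreal \<Rightarrow> (ennreal \<Rightarrow> ennreal \<Rightarrow> ennreal) \<Rightarrow> bool" where
  "admissible_fusion ybar fus \<longleftrightarrow>
     (\<forall>a\<in>{0..ybar}. \<forall>b\<in>{0..ybar}. fus a b \<in> {0..ybar}) \<and>
     (\<forall>a1\<in>{0..ybar}. \<forall>a2\<in>{0..ybar}. \<forall>b1\<in>{0..ybar}. \<forall>b2\<in>{0..ybar}.
        a1 \<le> b1 \<longrightarrow> a2 \<le> b2 \<longrightarrow> fus a1 a2 \<le> fus b1 b2) \<and>
     (\<forall>a\<in>{0..ybar}. fus 0 a \<le> a)"

definition level_set :: "'a measure \<Rightarrow> ('a \<Rightarrow> ennreal) \<Rightarrow> ennreal \<Rightarrow> 'a set" where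
  "level_set M f t = {x \<in> space M. f x \<ge> t}"

text \<open>The integral is indexed by \<open>n \<ge> 1\<close>; the value at \<open>n = 0\<close> is a dummy.\<close>

fun upper_sugeno ::
  "ennreal \<Rightarrow> (ennreal \<Rightarrow> ennreal \<Rightarrow> ennreal) \<Rightarrow> 'a measure \<Rightarrow> nat \<Rightarrow>
     ('a set \<Rightarrow> ennreal) \<Rightarrow> ('a \<Rightarrow> ennreal) \<Rightarrow> ennreal" where
  "upper_sugeno ybar fus M 0 \<mu> f = 0"
| "upper_sugeno ybar fus M (Suc 0) \<mu> f =
     (SUP t\<in>{0..ybar}. min t (\<mu> (level_set M f t)))"
| "upper_sugeno ybar fus M (Suc (Suc n)) \<mu> f =
     (SUP t\<in>{0..ybar}. min (fus t (upper_sugeno ybar fus M (Suc n) \<mu> f)) (\<mu> (level_set M f t)))"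

end

theory Submission
  imports Defs
begin

text \<open>
  Both monotonicity claims have one cause. The integral sees \<open>\<mu>\<close> and \<open>f\<close> only through the
  numbers \<open>\<mu> {f \<ge> t}\<close>, and it is built from them by minima, suprema and \<open>fus\<close>, all of which are
  nondecreasing; so it grows whenever all these numbers grow (\<open>upper_sugeno_mono_levels\<close>), be it
  because \<open>f\<close> changes or because \<open>\<mu>\<close> does. Monotonicity of \<open>fus\<close> is known on the scale only,
  which is why the integral has to be kept inside \<open>[0, ybar]\<close> (\<open>upper_sugeno_le_bound\<close>).

  For \<open>f = a * indicator A\<close> the level sets are \<open>space M\<close> at \<open>t = 0\<close>, \<open>A\<close> for \<open>0 < t \<le> a\<close>, and
  empty beyond \<open>a\<close>. Each supremum should therefore be attained at \<open>t = a\<close>; the one obstacle is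
  \<open>t = 0\<close>, where the level set is larger than \<open>A\<close>. There the condition \<open>fus 0 c \<le> c\<close> intervenes: with \<open>c\<close> the
  previous integral, which is at most \<open>\<mu> A\<close>, it shows that the term at \<open>t = 0\<close> does not exceed
  \<open>\<mu> A\<close> (\<open>SUP_min_level_set_indicator\<close>). The recursion for the integral thus collapses to the one
  for \<open>s\<^sub>n\<close>.
\<close>

lemma admissible_fusion_le_bound:
  assumes "admissible_fusion ybar fus" "a \<le> ybar" "b \<le> ybar"
  shows "fus a b \<le> ybar"
  using assms unfolding admissible_fusion_def by auto

lemma admissible_fusion_mono:
  assumes "admissible_fusion ybar fus" "a1 \<le> b1" "a2 \<le> b2" "b1 \<le> ybar" "b2 \<le> ybar"
  shows "fus a1 a2 \<le> fus b1 b2"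
proof -
  have "a1 \<le> ybar" "a2 \<le> ybar"
    using assms by (auto intro: order_trans)
  then show ?thesis
    using assms unfolding admissible_fusion_def by simp
qed

lemma admissible_fusion_zero_left:
  assumes "admissible_fusion ybar fus" "a \<le> ybar"
  shows "fus 0 a \<le> a"
  using assms unfolding admissible_fusion_def by simp

lemma level_set_sets:
  assumes "f \<in> measurable M (restrict_space borel {0..ybar})"
  shows "level_set M f t \<in> sets M"
proof -
  have [measurable]: "f \<in> borel_measurable M"
    using assms by (simp add: measurable_restrict_space2_iff)
  show ?thesis
    unfolding level_set_def by measurable
qed

lemma upper_sugeno_le_bound:
  assumes fus: "admissible_fusion ybar fus"
  shows "upper_sugeno ybar fus M n \<mu> f \<le> ybar"
proof (induction n rule: induct_nat_012)
  case 0
  show ?case by simp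
next
  case 1
  show ?case by (auto intro!: SUP_least intro: min.coboundedI1)
next
  case (ge2 n)
  then show ?case
    by (auto intro!: SUP_least min.coboundedI1 admissible_fusion_le_bound[OF fus])
qed

text \<open>Two measures and two functions may vary at once, so that the comparison of integrands and the
  comparison of measures are both instances.\<close>

lemma upper_sugeno_mono_levels:
  assumes fus: "admissible_fusion ybar fus"
    and le: "\<And>t. t \<le> ybar \<Longrightarrow> \<mu> (level_set M f t) \<le> \<nu> (level_set N g t)"
  shows "upper_sugeno ybar fus M n \<mu> f \<le> upper_sugeno ybar fus N n \<nu> g"
proof (induction n rule: induct_nat_012)
  case 0
  show ?case by simp
next
  case 1
  show ?case
    unfolding upper_sugeno.simps(2)
    by (intro SUP_subset_mono min.mono le) simp_all
next
  case (ge2 n)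
  then show ?case
    unfolding upper_sugeno.simps(3)
    by (intro SUP_subset_mono min.mono le admissible_fusion_mono[OF fus]
        upper_sugeno_le_bound[OF fus]) simp_all
qed

lemma level_set_indicator:
  assumes "A \<in> sets M"
  shows "level_set M (\<lambda>x. a * indicator A x) t =
    (if t = 0 then space M else if t \<le> a then A else {})"
  using sets.sets_into_space[OF assms]
  by (auto simp: level_set_def indicator_def)

text \<open>The integral of \<open>a * indicator A\<close> is a supremum of this shape at every stage, with
  \<open>\<Phi> t = t\<close> at the first and \<open>\<Phi> t = fus t c\<close> at the later ones. The hypothesis on \<open>\<Phi> 0\<close> is what
  keeps the term at \<open>t = 0\<close>, where \<open>A\<close> is replaced by the whole space, from dominating.\<close>

lemma SUP_min_level_set_indicator:
  fixes \<Phi> :: "ennreal \<Rightarrow> ennreal"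
  assumes \<mu>: "monotone_measure M \<mu>" and A: "A \<in> sets M" and a: "a \<le> ybar"
    and mono: "\<And>t. t \<le> a \<Longrightarrow> \<Phi> t \<le> \<Phi> a"
    and zero: "\<Phi> 0 \<le> \<mu> A"
  shows "(SUP t\<in>{0..ybar}. min (\<Phi> t) (\<mu> (level_set M (\<lambda>x. a * indicator A x) t)))
    = min (\<Phi> a) (\<mu> A)"
proof (rule antisym)
  show "(SUP t\<in>{0..ybar}. min (\<Phi> t) (\<mu> (level_set M (\<lambda>x. a * indicator A x) t)))
    \<le> min (\<Phi> a) (\<mu> A)"
  proof (rule SUP_least)
    fix t
    have "\<mu> {} = 0"
      using \<mu> by (simp add: monotone_measure_def)
    then show "min (\<Phi> t) (\<mu> (level_set M (\<lambda>x. a * indicator A x) t)) \<le> min (\<Phi> a) (\<mu> A)"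
      using mono[of t] mono[of 0] zero
      by (auto simp: level_set_indicator[OF A] intro: min.coboundedI1 min.coboundedI2)
  qed
next
  \<comment> \<open>When \<open>a = 0\<close>, the level set is the whole space, so the two values can differ.\<close>
  have "\<mu> A \<le> \<mu> (level_set M (\<lambda>x. a * indicator A x) a)"
    using \<mu> A sets.sets_into_space[OF A]
    by (auto simp: level_set_indicator[OF A] monotone_measure_def)
  then have "min (\<Phi> a) (\<mu> A) \<le> min (\<Phi> a) (\<mu> (level_set M (\<lambda>x. a * indicator A x) a))"
    by (intro min.mono) auto
  also have "\<dots> \<le> (SUP t\<in>{0..ybar}. min (\<Phi> t) (\<mu> (level_set M (\<lambda>x. a * indicator A x) t)))"
    using a by (intro SUP_upper) auto
  finally show "min (\<Phi> a) (\<mu> A)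
    \<le> (SUP t\<in>{0..ybar}. min (\<Phi> t) (\<mu> (level_set M (\<lambda>x. a * indicator A x) t)))" .
qed

text \<open>The functions \<open>s\<^sub>n\<close> with indices shifted by one: \<open>sugeno_scale fus n\<close> is \<open>s\<^bsub>n + 1\<^esub>\<close>, so that
  the recursion starts at \<open>0\<close>.\<close>

primrec sugeno_scale ::
  "(ennreal \<Rightarrow> ennreal \<Rightarrow> ennreal) \<Rightarrow> nat \<Rightarrow> ennreal \<Rightarrow> ennreal \<Rightarrow> ennreal" where
  "sugeno_scale fus 0 a b = min a b"
| "sugeno_scale fus (Suc n) a b = min (fus a (sugeno_scale fus n a b)) b"

lemma sugeno_scale_le_right: "sugeno_scale fus n a b \<le> b"
  by (cases n) auto

lemma sugeno_scale_le_bound: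
  assumes "admissible_fusion ybar fus" "a \<le> ybar"
  shows "sugeno_scale fus n a b \<le> ybar"
  using assms by (induction n) (auto intro: min.coboundedI1 admissible_fusion_le_bound)

lemma sugeno_scale_mono:
  assumes "admissible_fusion ybar fus" "a \<le> a'" "a' \<le> ybar" "b \<le> b'"
  shows "sugeno_scale fus n a b \<le> sugeno_scale fus n a' b'"
proof (induction n)
  case 0
  show ?case using assms unfolding sugeno_scale.simps by (intro min.mono)
next
  case (Suc n)
  then show ?case
    using assms unfolding sugeno_scale.simps
    by (intro min.mono admissible_fusion_mono[OF assms(1)] sugeno_scale_le_bound[OF assms(1)])
qed

lemma sugeno_scale_zero_left:
  assumes "admissible_fusion ybar fus"
  shows "sugeno_scale fus n 0 b = 0"
  using admissible_fusion_zero_left[OF assms, of 0] by (induction n) auto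

lemma upper_sugeno_indicator:
  assumes fus: "admissible_fusion ybar fus" and \<mu>: "monotone_measure M \<mu>"
    and a: "a \<le> ybar" and A: "A \<in> sets M"
  shows "upper_sugeno ybar fus M (Suc n) \<mu> (\<lambda>x. a * indicator A x) = sugeno_scale fus n a (\<mu> A)"
proof (induction n)
  case 0
  show ?case
    using SUP_min_level_set_indicator[OF \<mu> A a, where \<Phi> = "\<lambda>t. t"] by simp
next
  case (Suc n)
  let ?c = "sugeno_scale fus n a (\<mu> A)"
  have c: "?c \<le> ybar"
    by (rule sugeno_scale_le_bound[OF fus a])
  have "fus 0 ?c \<le> \<mu> A"
    using admissible_fusion_zero_left[OF fus c] sugeno_scale_le_right by (rule order_trans)
  then have "(SUP t\<in>{0..ybar}. min (fus t ?c) (\<mu> (level_set M (\<lambda>x. a * indicator A x) t)))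
    = min (fus a ?c) (\<mu> A)"
    using a c
    by (intro SUP_min_level_set_indicator[OF \<mu> A a, where \<Phi> = "\<lambda>t. fus t ?c"]
        admissible_fusion_mono[OF fus]) auto
  then show ?case
    by (simp only: upper_sugeno.simps Suc.IH sugeno_scale.simps)
qed

theorem proposition3p2:
  fixes ybar :: ennreal and fus :: "ennreal \<Rightarrow> ennreal \<Rightarrow> ennreal"
  assumes "0 < ybar"
    and "admissible_fusion ybar fus"
  shows
    "(\<forall>(M :: 'a measure) \<mu> f g. \<forall>n\<ge>1.
        space M \<noteq> {} \<longrightarrow> monotone_measure M \<mu> \<longrightarrow>
        f \<in> measurable M (restrict_space borel {0..ybar}) \<longrightarrow>
        g \<in> measurable M (restrict_space borel {0..ybar}) \<longrightarrow>
        (\<forall>t\<in>{0..ybar}. \<mu> (level_set M f t) \<le> \<mu> (level_set M g t)) \<longrightarrow>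
        upper_sugeno ybar fus M n \<mu> f \<le> upper_sugeno ybar fus M n \<mu> g) \<and>
     (\<forall>(M :: 'a measure) \<mu> \<nu> f. \<forall>n\<ge>1.
        space M \<noteq> {} \<longrightarrow> monotone_measure M \<mu> \<longrightarrow> monotone_measure M \<nu> \<longrightarrow>
        f \<in> measurable M (restrict_space borel {0..ybar}) \<longrightarrow>
        (\<forall>A\<in>sets M. \<mu> A \<le> \<nu> A) \<longrightarrow>
        upper_sugeno ybar fus M n \<mu> f \<le> upper_sugeno ybar fus M n \<nu> f) \<and>
     (\<exists>s :: nat \<Rightarrow> ennreal \<Rightarrow> ennreal \<Rightarrow> ennreal.
        (\<forall>n\<ge>1.
           (\<forall>a\<in>{0..ybar}. \<forall>b. s n a b \<in> {0..ybar}) \<and>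
           (\<forall>a\<in>{0..ybar}. \<forall>a'\<in>{0..ybar}. \<forall>b b'. a \<le> a' \<longrightarrow> b \<le> b' \<longrightarrow> s n a b \<le> s n a' b') \<and>
           (\<forall>a\<in>{0..ybar}. s n a 0 = 0) \<and>
           (\<forall>b. s n 0 b = 0) \<and>
           (\<forall>a\<in>{0..ybar}. \<forall>b. s (Suc n) a b = min (fus a (s n a b)) b)) \<and>
        (\<forall>(M :: 'a measure) \<mu>. \<forall>n\<ge>1.
           space M \<noteq> {} \<longrightarrow> monotone_measure M \<mu> \<longrightarrow>
           (\<forall>a\<in>{0..ybar}. \<forall>A\<in>sets M.
              upper_sugeno ybar fus M n \<mu> (\<lambda>x. a * indicator A x) = s n a (\<mu> A))))"
proof (intro conjI)
  note fus = assms(2)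
  show "\<forall>(M :: 'a measure) \<mu> f g. \<forall>n\<ge>1.
      space M \<noteq> {} \<longrightarrow> monotone_measure M \<mu> \<longrightarrow>
      f \<in> measurable M (restrict_space borel {0..ybar}) \<longrightarrow>
      g \<in> measurable M (restrict_space borel {0..ybar}) \<longrightarrow>
      (\<forall>t\<in>{0..ybar}. \<mu> (level_set M f t) \<le> \<mu> (level_set M g t)) \<longrightarrow>
      upper_sugeno ybar fus M n \<mu> f \<le> upper_sugeno ybar fus M n \<mu> g"
    by (intro allI impI upper_sugeno_mono_levels[OF fus]) auto
  show "\<forall>(M :: 'a measure) \<mu> \<nu> f. \<forall>n\<ge>1.
      space M \<noteq> {} \<longrightarrow> monotone_measure M \<mu> \<longrightarrow> monotone_measure M \<nu> \<longrightarrow>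
      f \<in> measurable M (restrict_space borel {0..ybar}) \<longrightarrow>
      (\<forall>A\<in>sets M. \<mu> A \<le> \<nu> A) \<longrightarrow>
      upper_sugeno ybar fus M n \<mu> f \<le> upper_sugeno ybar fus M n \<nu> f"
    by (intro allI impI upper_sugeno_mono_levels[OF fus]) (blast intro: level_set_sets)
  let ?s = "\<lambda>n. sugeno_scale fus (n - 1)"
  have scale: "(\<forall>a\<in>{0..ybar}. \<forall>b. ?s n a b \<in> {0..ybar}) \<and>
      (\<forall>a\<in>{0..ybar}. \<forall>a'\<in>{0..ybar}. \<forall>b b'. a \<le> a' \<longrightarrow> b \<le> b' \<longrightarrow> ?s n a b \<le> ?s n a' b') \<and>
      (\<forall>a\<in>{0..ybar}. ?s n a 0 = 0) \<and>
      (\<forall>b. ?s n 0 b = 0) \<and>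
      (\<forall>a\<in>{0..ybar}. \<forall>b. ?s (Suc n) a b = min (fus a (?s n a b)) b)" if n: "n \<ge> 1" for n
  proof (intro conjI ballI allI impI)
    fix a b :: ennreal assume a: "a \<in> {0..ybar}"
    show "?s n a b \<in> {0..ybar}"
      using a sugeno_scale_le_bound[OF fus] by simp
    show "?s n a 0 = 0"
      using sugeno_scale_le_right[of fus "n - 1" a 0] by simp
    show "?s (Suc n) a b = min (fus a (?s n a b)) b"
      using n by (cases n) simp_all
  next
    fix a a' b b' :: ennreal assume "a' \<in> {0..ybar}" "a \<le> a'" "b \<le> b'"
    then show "?s n a b \<le> ?s n a' b'"
      using sugeno_scale_mono[OF fus] by simp
  next
    fix b :: ennreal
    show "?s n 0 b = 0"
      by (rule sugeno_scale_zero_left[OF fus])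
  qed
  have integral: "upper_sugeno ybar fus M n \<mu> (\<lambda>x. a * indicator A x) = ?s n a (\<mu> A)"
    if "n \<ge> 1" "monotone_measure M \<mu>" "a \<in> {0..ybar}" "A \<in> sets M"
    for n a and M :: "'a measure" and \<mu> A
    using that upper_sugeno_indicator[OF fus, of M \<mu> a A "n - 1"] by simp
  show "\<exists>s :: nat \<Rightarrow> ennreal \<Rightarrow> ennreal \<Rightarrow> ennreal.
        (\<forall>n\<ge>1.
           (\<forall>a\<in>{0..ybar}. \<forall>b. s n a b \<in> {0..ybar}) \<and>
           (\<forall>a\<in>{0..ybar}. \<forall>a'\<in>{0..ybar}. \<forall>b b'. a \<le> a' \<longrightarrow> b \<le> b' \<longrightarrow> s n a b \<le> s n a' b') \<and>
           (\<forall>a\<in>{0..ybar}. s n a 0 = 0) \<and>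
           (\<forall>b. s n 0 b = 0) \<and>
           (\<forall>a\<in>{0..ybar}. \<forall>b. s (Suc n) a b = min (fus a (s n a b)) b)) \<and>
        (\<forall>(M :: 'a measure) \<mu>. \<forall>n\<ge>1.
           space M \<noteq> {} \<longrightarrow> monotone_measure M \<mu> \<longrightarrow>
           (\<forall>a\<in>{0..ybar}. \<forall>A\<in>sets M.
              upper_sugeno ybar fus M n \<mu> (\<lambda>x. a * indicator A x) = s n a (\<mu> A)))"
  proof (rule exI[of _ ?s], rule conjI, goal_cases)
    case 1
    show ?case using scale by (intro allI impI)
  next
    case 2
    show ?case by (intro allI impI ballI integral)
  qed
qed

end
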